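(* Let $c>0$ and let $R$ be the $\pi$-periodic function with $$R(t)=\begin{cases}1 & \text{if } t\in\left[0,\frac\pi2\right),\\ c & \text{if } t\in\left[\frac\pi2,\pi\right).\end{cases}$$ If $c\neq1$, then all solutions of $$\ddot x+x=\frac{R(t)}{x^3},\qquad x>0,$$ are unbounded.
   Context: The equation is understood in the Carathéodory sense. A solution $x(t)$ is called unbounded if there is a sequence $(t_n)$ such that $|x(t_n)|+|\dot x(t_n)|\to+\infty$. *)

theory Defs
  imports "HOL-Analysis.Analysis"
begin

text \<open>
  Pointwise absolute continuity of a real function; the library's \<^const>\<open>absolutely_continuous\<close>
  is a relation between measures. The members of \<open>D\<close> are compact intervals with pairwise
  disjoint interiors, so \<open>Inf K\<close> and \<open>Sup K\<close> are the endpoints of \<open>K\<close>.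
\<close>

definition abs_continuous_on :: "real set \<Rightarrow> (real \<Rightarrow> real) \<Rightarrow> bool" where
  "abs_continuous_on S f \<longleftrightarrow>
     (\<forall>\<epsilon>>0. \<exists>\<delta>>0. \<forall>D. D division_of \<Union>D \<and> \<Union>D \<subseteq> S \<and> (\<Sum>K\<in>D. Sup K - Inf K) < \<delta> \<longrightarrow>
        (\<Sum>K\<in>D. \<bar>f (Sup K) - f (Inf K)\<bar>) < \<epsilon>)"

text \<open>
  Positive Caratheodory solutions of \<open>x'' + x = R(t) / x\<^sup>3\<close> on a nonempty open interval \<open>I\<close>:
  \<open>x\<close> is differentiable with locally absolutely continuous derivative, and the equation holds
  almost everywhere. Values of \<open>x\<close> outside \<open>I\<close> are irrelevant.
\<close>

definition caratheodory_solution :: "(real \<Rightarrow> real) \<Rightarrow> real set \<Rightarrow> (real \<Rightarrow> real) \<Rightarrow> bool" where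
  "caratheodory_solution R I x \<longleftrightarrow>
     open I \<and> is_interval I \<and> I \<noteq> {} \<and>
     (\<forall>t\<in>I. x t > 0) \<and>
     x differentiable_on I \<and>
     (\<forall>a b. {a..b} \<subseteq> I \<longrightarrow> abs_continuous_on {a..b} (deriv x)) \<and>
     (AE t in lebesgue. t \<in> I \<longrightarrow>
        (\<exists>a. (deriv x has_real_derivative a) (at t) \<and> a + x t = R t / x t ^ 3))"

definition maximal_solution :: "(real \<Rightarrow> real) \<Rightarrow> real set \<Rightarrow> (real \<Rightarrow> real) \<Rightarrow> bool" where
  "maximal_solution R I x \<longleftrightarrow>
     caratheodory_solution R I x \<and>
     \<not> (\<exists>J y. I \<subset> J \<and> caratheodory_solution R J y \<and> (\<forall>t\<in>I. y t = x t))"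

definition unbounded_on :: "real set \<Rightarrow> (real \<Rightarrow> real) \<Rightarrow> bool" where
  "unbounded_on I x \<longleftrightarrow>
     (\<exists>\<tau>::nat \<Rightarrow> real. (\<forall>n. \<tau> n \<in> I) \<and>
        filterlim (\<lambda>n. \<bar>x (\<tau> n)\<bar> + \<bar>deriv x (\<tau> n)\<bar>) at_top sequentially)"

end

theory Submission
  imports Defs
begin

text \<open>
  Where \<open>R\<close> is a constant \<open>r\<close>, the solutions are
  \<open>x\<^sup>2 = a cos\<^sup>2 t + b sin\<^sup>2 t + v sin t cos t\<close> with \<open>a b - v\<^sup>2 / 4 = r\<close>. When \<open>R\<close> jumps at a zero of
  \<open>cos\<close>, matching \<open>x\<close> and \<open>x'\<close> preserves \<open>b\<close> and \<open>v\<close> and changes only \<open>a\<close>; at a zero of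
  \<open>sin\<close> the roles of \<open>a\<close> and \<open>b\<close> are exchanged. So \<open>v\<close> is a global constant of motion, and over
  one period \<open>a\<close> is multiplied and \<open>b\<close> divided by \<open>q = (v\<^sup>2 / 4 + c) / (v\<^sup>2 / 4 + 1)\<close>, which
  differs from \<open>1\<close>. Since \<open>x(n \<pi>)\<^sup>2 = a\<close> and \<open>x(n \<pi> + \<pi> / 2)\<^sup>2 = b\<close>, one of these sequences tends
  to infinity. The explicit formula defines a solution on the whole line, so by uniqueness every
  maximal solution is of this form.
\<close>

section \<open>Absolutely continuous functions\<close>

text \<open>Since \<open>t\<close> separates \<open>u\<close> from \<open>v\<close>, the errors
  \<open>e * (t - u)\<close> and \<open>e * (v - t)\<close> of the linear approximation at the two
  ends add up to exactly \<open>e * (v - u)\<close>. This is the estimate for intervals tagged at a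
  point of differentiability.\<close>

lemma has_real_derivative_straddle:
  fixes f :: "real \<Rightarrow> real"
  assumes "(f has_real_derivative f') (at t)" "e > 0"
  shows "\<exists>d>0. \<forall>u v. u \<le> t \<longrightarrow> t \<le> v \<longrightarrow> {u..v} \<subseteq> ball t d \<longrightarrow>
           \<bar>(v - u) * f' - (f v - f u)\<bar> \<le> e * (v - u)"
proof -
  from assms obtain d where d: "d > 0"
    "\<And>y. \<bar>y - t\<bar> < d \<Longrightarrow> \<bar>f y - f t - f' * (y - t)\<bar> \<le> e * \<bar>y - t\<bar>"
    unfolding has_field_derivative_def has_derivative_at_alt by (auto simp: mult.commute)
  have "\<bar>(v - u) * f' - (f v - f u)\<bar> \<le> e * (v - u)"
    if "u \<le> t" "t \<le> v" "{u..v} \<subseteq> ball t d" for u v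
  proof -
    have "u \<in> ball t d" "v \<in> ball t d"
      using that by (auto simp del: mem_ball)
    then have "\<bar>f u - f t - f' * (u - t)\<bar> \<le> e * (t - u)" "\<bar>f v - f t - f' * (v - t)\<bar> \<le> e * (v - t)"
      using d(2)[of u] d(2)[of v] that(1,2) by (simp_all add: dist_real_def abs_minus_commute)
    then show ?thesis
      by (auto simp: algebra_simps abs_le_iff)
  qed
  with d(1) show ?thesis by blast
qed

lemma negligible_outer_open:
  fixes N :: "real set" and d :: real
  assumes "negligible N" "d > 0"
  obtains U where "open U" "N \<subseteq> U" "U \<in> lmeasurable" "measure lebesgue U < d"
proof -
  have N: "N \<in> null_sets lebesgue"
    using assms negligible_iff_null_sets by blast
  then obtain U where U: "open U" "N \<subseteq> U" "emeasure lebesgue (U - N) < ennreal d"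
    using sets_lebesgue_outer_open[of N d] assms(2) by blast
  have "emeasure lebesgue (U - N) = emeasure lebesgue U"
    using N U(1) by (intro emeasure_Diff_null_set) auto
  with U(3) have less: "emeasure lebesgue U < ennreal d" by simp
  then have "U \<in> lmeasurable"
    using U(1) by (intro fmeasurableI) (auto simp: less_top[symmetric] top_unique)
  moreover from this have "measure lebesgue U < d"
    using less by (simp add: emeasure_eq_measure2 ennreal_less_iff)
  ultimately show ?thesis using that U by blast
qed

text \<open>
  A Henstock argument: subintervals tagged in \<open>N\<close> are confined to an open set of small measure and
  controlled by absolute continuity, the others by differentiability at the tag.
\<close>

theorem abs_continuous_fundamental_theorem:
  fixes f g :: "real \<Rightarrow> real"
  assumes "a \<le> b" and ac: "abs_continuous_on {a..b} f"
    and N: "negligible N"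
    and deriv: "\<And>t. t \<in> {a..b} - N \<Longrightarrow> (f has_real_derivative g t) (at t)"
  shows "(g has_integral (f b - f a)) {a..b}"
proof -
  \<comment> \<open>With the value 0 on \<open>N\<close>, an interval tagged in \<open>N\<close>
    contributes nothing to the Riemann sum, so its error is just the increment of \<open>f\<close>.
    The change is undone at the end, \<open>N\<close> being negligible.\<close>
  define g0 where "g0 = (\<lambda>t. if t \<in> N then 0 else g t)"
  have "(g0 has_integral (f b - f a)) {a..b}"
    unfolding has_integral_real
  proof (intro allI impI)
    fix e :: real assume "e > 0"
    then obtain d where "d > 0" and d:
      "\<And>D. \<lbrakk>D division_of \<Union>D; \<Union>D \<subseteq> {a..b}; (\<Sum>K\<in>D. Sup K - Inf K) < d\<rbrakk> \<Longrightarrow>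
        (\<Sum>K\<in>D. \<bar>f (Sup K) - f (Inf K)\<bar>) < e / 2"
      using ac[unfolded abs_continuous_on_def, rule_format, of "e / 2"] by auto
    obtain U where U: "open U" "N \<subseteq> U" "U \<in> lmeasurable" "measure lebesgue U < d"
      using negligible_outer_open[OF N \<open>d > 0\<close>] .
    \<comment> \<open>The \<open>+ 1\<close> keeps the denominator positive when
      \<open>a = b\<close> and makes the second bound below strict.\<close>
    define e' where "e' = e / (2 * (b - a + 1))"
    have e': "e' > 0" "e' * (b - a) < e / 2"
      using \<open>e > 0\<close> \<open>a \<le> b\<close> by (auto simp: e'_def field_simps)
    have "\<forall>t. \<exists>r>0. (t \<in> N \<longrightarrow> ball t r \<subseteq> U) \<and> (t \<in> {a..b} - N \<longrightarrow>
        (\<forall>u v. u \<le> t \<longrightarrow> t \<le> v \<longrightarrow> {u..v} \<subseteq> ball t r \<longrightarrow>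
           \<bar>(v - u) * g t - (f v - f u)\<bar> \<le> e' * (v - u)))"
    proof
      fix t
      show "\<exists>r>0. (t \<in> N \<longrightarrow> ball t r \<subseteq> U) \<and> (t \<in> {a..b} - N \<longrightarrow>
        (\<forall>u v. u \<le> t \<longrightarrow> t \<le> v \<longrightarrow> {u..v} \<subseteq> ball t r \<longrightarrow>
           \<bar>(v - u) * g t - (f v - f u)\<bar> \<le> e' * (v - u)))"
      proof (cases "t \<in> N")
        case True
        then show ?thesis using U(1,2) open_contains_ball by auto
      next
        case False
        then show ?thesis
          using has_real_derivative_straddle[OF deriv e'(1), of t] zero_less_one[where 'a=real]
          by (cases "t \<in> {a..b}") blast+
      qed
    qed
    from choice[OF this] obtain r where r: "\<And>t. r t > 0" "\<And>t. t \<in> N \<Longrightarrow> ball t (r t) \<subseteq> U"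
      "\<And>t u v. \<lbrakk>t \<in> {a..b} - N; u \<le> t; t \<le> v; {u..v} \<subseteq> ball t (r t)\<rbrakk> \<Longrightarrow>
           \<bar>(v - u) * g t - (f v - f u)\<bar> \<le> e' * (v - u)"
      by blast
    show "\<exists>\<gamma>. gauge \<gamma> \<and> (\<forall>\<D>. \<D> tagged_division_of {a..b} \<and> \<gamma> fine \<D> \<longrightarrow>
        norm ((\<Sum>(x,k)\<in>\<D>. measure lborel k *\<^sub>R g0 x) - (f b - f a)) < e)"
    proof (intro exI conjI allI impI; (elim conjE)?)
      show "gauge (\<lambda>t. ball t (r t))"
        using r(1) by (simp add: gauge_def)
      fix p assume p: "p tagged_division_of {a..b}" and fine: "(\<lambda>t. ball t (r t)) fine p"
      note pD = tagged_division_ofD[OF p]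
      have piece: "\<exists>u v. K = {u..v} \<and> u \<le> t \<and> t \<le> v \<and> Inf K = u \<and> Sup K = v \<and>
          measure lborel K = v - u \<and> {u..v} \<subseteq> ball t (r t) \<and> t \<in> {a..b}" if tK: "(t, K) \<in> p" for t K
      proof -
        obtain u v where "K = {u..v}" "t \<in> K" using pD(4)[OF tK] pD(2)[OF tK] by auto
        then show ?thesis using pD(2,3)[OF tK] fineD[OF fine tK] by auto
      qed
      define q where "q = {(t, K) \<in> p. t \<in> N}"
      have "finite p" "q \<subseteq> p" using pD(1) by (auto simp: q_def)
      have q_tagged: "q tagged_division_of \<Union>(snd ` q)"
        by (rule tagged_partial_division_of_Union_self[OF tagged_partial_division_subset[OF _ \<open>q \<subseteq> p\<close>]])
          (use p in \<open>auto simp: tagged_division_of_def\<close>)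
      note D = division_of_tagged_division[OF q_tagged]
      have "(\<Sum>K\<in>snd ` q. Sup K - Inf K) = (\<Sum>K\<in>snd ` q. measure lebesgue K)"
      proof (rule sum.cong)
        fix K assume "K \<in> snd ` q"
        then obtain t where "(t, K) \<in> p" using \<open>q \<subseteq> p\<close> by auto
        from piece[OF this] obtain u v where "K = {u..v}" "u \<le> v" by (metis order_trans)
        then show "Sup K - Inf K = measure lebesgue K" by simp
      qed simp
      also have "\<dots> = measure lebesgue (\<Union>(snd ` q))"
        by (rule content_division[OF D])
      also have "\<dots> \<le> measure lebesgue U"
      proof (rule measure_mono_fmeasurable)
        show "\<Union>(snd ` q) \<subseteq> U"
        proof safe
          fix s t K assume "(t, K) \<in> q" "s \<in> snd (t, K)"
          then have "(t, K) \<in> p" "t \<in> N" "s \<in> K" by (auto simp: q_def)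
          then show "s \<in> U" using piece[of t K] r(2)[of t] by blast
        qed
      qed (use U(3) lmeasurable_division[OF D] in auto)
      finally have "(\<Sum>K\<in>snd ` q. Sup K - Inf K) < d" using U(4) by simp
      moreover have "\<Union>(snd ` q) \<subseteq> {a..b}"
      proof safe
        fix s t K assume "(t, K) \<in> q" "s \<in> snd (t, K)"
        then have "(t, K) \<in> p" "s \<in> K" using \<open>q \<subseteq> p\<close> by auto
        then show "s \<in> {a..b}" using pD(3) by blast
      qed
      ultimately have "(\<Sum>K\<in>snd ` q. \<bar>f (Sup K) - f (Inf K)\<bar>) < e / 2"
        using d[OF D] by simp
      moreover have "(\<Sum>(t,K)\<in>q. \<bar>f (Sup K) - f (Inf K)\<bar>) = (\<Sum>K\<in>snd ` q. \<bar>f (Sup K) - f (Inf K)\<bar>)"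
      proof -
        \<comment> \<open>Distinct pairs of \<open>q\<close> can share an interval only if it has
          empty interior, so passing from pairs to intervals needs a function vanishing on such
          intervals. The empty set counts among them, and there \<open>Sup\<close> and
          \<open>Inf\<close> carry no information, hence the default 0.\<close>
        define h where "h K = (if K = {} then 0 else \<bar>f (Sup K) - f (Inf K)\<bar>)" for K
        have h: "h K = \<bar>f (Sup K) - f (Inf K)\<bar>" if "(t, K) \<in> q" for t K
          using pD(2) that \<open>q \<subseteq> p\<close> by (auto simp: h_def)
        have "(\<Sum>(t,K)\<in>q. h K) = sum h (snd ` q)"
        proof (rule sum.over_tagged_division_lemma[OF q_tagged])
          fix u v :: real assume "box u v = {}"
          then show "h (cbox u v) = 0" by (cases "u = v") (auto simp: h_def)
        qed
        moreover have "(\<Sum>(t,K)\<in>q. h K) = (\<Sum>(t,K)\<in>q. \<bar>f (Sup K) - f (Inf K)\<bar>)"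
          by (intro sum.cong) (auto simp: h)
        moreover have "sum h (snd ` q) = (\<Sum>K\<in>snd ` q. \<bar>f (Sup K) - f (Inf K)\<bar>)"
          by (intro sum.cong) (auto simp: h)
        ultimately show ?thesis by simp
      qed
      ultimately have bad: "(\<Sum>(t,K)\<in>q. \<bar>f (Sup K) - f (Inf K)\<bar>) < e / 2" by simp
      have "(\<Sum>(t,K)\<in>p - q. \<bar>measure lborel K * g0 t - (f (Sup K) - f (Inf K))\<bar>) \<le> (\<Sum>(t,K)\<in>p - q. e' * measure lborel K)"
      proof (rule sum_mono, clarify)
        fix t K assume "(t, K) \<in> p" "(t, K) \<notin> q"
        then have "t \<notin> N" by (auto simp: q_def)
        with piece[OF \<open>(t, K) \<in> p\<close>] r(3)[of t "Inf K" "Sup K"]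
        show "\<bar>measure lborel K * g0 t - (f (Sup K) - f (Inf K))\<bar> \<le> e' * measure lborel K"
          by (auto simp: g0_def)
      qed
      also have "\<dots> \<le> (\<Sum>(t,K)\<in>p. e' * measure lborel K)"
        using \<open>finite p\<close> e'(1) by (intro sum_mono2) auto
      also have "\<dots> = e' * (b - a)"
        using additive_content_tagged_division[of p a b] p \<open>a \<le> b\<close>
        by (simp add: sum_distrib_left[symmetric] case_prod_unfold)
      finally have good: "(\<Sum>(t,K)\<in>p - q. \<bar>measure lborel K * g0 t - (f (Sup K) - f (Inf K))\<bar>) < e / 2"
        using e'(2) by simp
      have "\<bar>(\<Sum>(t,K)\<in>p. measure lborel K * g0 t) - (f b - f a)\<bar> =
          \<bar>\<Sum>(t,K)\<in>p. measure lborel K * g0 t - (f (Sup K) - f (Inf K))\<bar>"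
        using additive_tagged_division_1[OF \<open>a \<le> b\<close> p, of f]
        by (simp add: sum_subtractf case_prod_unfold)
      also have "\<dots> \<le> (\<Sum>(t,K)\<in>p. \<bar>measure lborel K * g0 t - (f (Sup K) - f (Inf K))\<bar>)"
        by (rule order_trans[OF sum_abs]) (simp add: case_prod_unfold)
      also have "\<dots> = (\<Sum>(t,K)\<in>p - q. \<bar>measure lborel K * g0 t - (f (Sup K) - f (Inf K))\<bar>) +
          (\<Sum>(t,K)\<in>q. \<bar>measure lborel K * g0 t - (f (Sup K) - f (Inf K))\<bar>)"
        using \<open>finite p\<close> \<open>q \<subseteq> p\<close> by (rule sum.subset_diff[rotated])
      also have "(\<Sum>(t,K)\<in>q. \<bar>measure lborel K * g0 t - (f (Sup K) - f (Inf K))\<bar>) =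
          (\<Sum>(t,K)\<in>q. \<bar>f (Sup K) - f (Inf K)\<bar>)"
        by (intro sum.cong) (auto simp: q_def g0_def)
      finally show "norm ((\<Sum>(x,k)\<in>p. measure lborel k *\<^sub>R g0 x) - (f b - f a)) < e"
        using good bad by simp
    qed
  qed
  then show ?thesis
    using N by (rule has_integral_spike[rotated 2]) (auto simp: g0_def)
qed

lemma lipschitz_imp_abs_continuous_on:
  assumes "L \<ge> 0" and lip: "\<And>s t. a \<le> s \<Longrightarrow> s \<le> t \<Longrightarrow> t \<le> b \<Longrightarrow> \<bar>f t - f s\<bar> \<le> L * (t - s)"
  shows "abs_continuous_on {a..b} f"
  unfolding abs_continuous_on_def
proof (intro allI impI)
  fix e :: real assume "e > 0"
  show "\<exists>\<delta>>0. \<forall>D. D division_of \<Union>D \<and> \<Union>D \<subseteq> {a..b} \<and> (\<Sum>K\<in>D. Sup K - Inf K) < \<delta> \<longrightarrow>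
        (\<Sum>K\<in>D. \<bar>f (Sup K) - f (Inf K)\<bar>) < e"
  proof (intro exI[of _ "e / (L + 1)"] conjI allI impI; (elim conjE)?)
    show "e / (L + 1) > 0" using \<open>e > 0\<close> \<open>L \<ge> 0\<close> by simp
    fix D assume D: "D division_of \<Union>D" "\<Union>D \<subseteq> {a..b}" "(\<Sum>K\<in>D. Sup K - Inf K) < e / (L + 1)"
    have bound: "\<bar>f (Sup K) - f (Inf K)\<bar> \<le> L * (Sup K - Inf K) \<and> 0 \<le> Sup K - Inf K" if K: "K \<in> D" for K
    proof -
      obtain u v where "K = {u..v}" "K \<noteq> {}"
        using division_ofD(3,4)[OF D(1) K] by auto
      then have uv: "K = {u..v}" "u \<le> v" by auto
      then have "u \<in> {a..b}" "v \<in> {a..b}" using D(2) K by (fastforce simp: subset_iff)+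
      then show ?thesis using uv lip[of u v] by simp
    qed
    have "(\<Sum>K\<in>D. \<bar>f (Sup K) - f (Inf K)\<bar>) \<le> L * (\<Sum>K\<in>D. Sup K - Inf K)"
      using bound by (simp add: sum_distrib_left sum_mono)
    also have "\<dots> \<le> (L + 1) * (\<Sum>K\<in>D. Sup K - Inf K)"
      using bound by (intro mult_right_mono sum_nonneg) auto
    also have "\<dots> < e"
      using D(3) \<open>L \<ge> 0\<close> by (simp add: field_simps)
    finally show "(\<Sum>K\<in>D. \<bar>f (Sup K) - f (Inf K)\<bar>) < e" .
  qed
qed

section \<open>First integrals and uniqueness\<close>

text \<open>
  The coefficients \<open>a\<close>, \<open>b\<close>, \<open>v\<close> as functions of the state \<open>(x, y) = (x, x')\<close> at time \<open>t\<close>.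
\<close>

definition cos_coeff :: "real \<Rightarrow> real \<Rightarrow> real \<Rightarrow> real \<Rightarrow> real" where
  "cos_coeff r t x y = (x * cos t - y * sin t)\<^sup>2 + r * (sin t)\<^sup>2 / x\<^sup>2"

definition sin_coeff :: "real \<Rightarrow> real \<Rightarrow> real \<Rightarrow> real \<Rightarrow> real" where
  "sin_coeff r t x y = (x * sin t + y * cos t)\<^sup>2 + r * (cos t)\<^sup>2 / x\<^sup>2"

definition mixed_coeff :: "real \<Rightarrow> real \<Rightarrow> real \<Rightarrow> real \<Rightarrow> real" where
  "mixed_coeff r t x y =
     2 * (x * cos t - y * sin t) * (x * sin t + y * cos t) - 2 * r * sin t * cos t / x\<^sup>2"

lemmas coeff_defs = cos_coeff_def sin_coeff_def mixed_coeff_def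

text \<open>In the rotated coordinates \<open>X\<close>, \<open>Y\<close> the \<open>q\<close> terms
  cancel in the first two identities, leaving \<open>x = X cos t + Y sin t\<close> squared and twice
  the product of \<open>x\<close> and \<open>y\<close>. In the third the \<open>X\<close>,
  \<open>Y\<close> terms of degree four and the terms in the square of \<open>q\<close> cancel,
  leaving \<open>q\<close> times the square of \<open>x\<close>. The first two recover the state
  from the coefficients, the third ties \<open>a\<close>, \<open>b\<close>, \<open>v\<close> to
  \<open>r\<close>.\<close>

lemma coeff_reconstruct:
  assumes "x \<noteq> 0"
  shows "cos_coeff r t x y * (cos t)\<^sup>2 + sin_coeff r t x y * (sin t)\<^sup>2
           + mixed_coeff r t x y * sin t * cos t = x\<^sup>2" (is "?l = _")
    and "2 * (sin_coeff r t x y - cos_coeff r t x y) * sin t * cos t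
           + mixed_coeff r t x y * ((cos t)\<^sup>2 - (sin t)\<^sup>2) = 2 * x * y" (is "?m = _")
    and "cos_coeff r t x y * sin_coeff r t x y - (mixed_coeff r t x y)\<^sup>2 / 4 = r" (is "?n = _")
proof -
  define X Y q where "X = x * cos t - y * sin t" and "Y = x * sin t + y * cos t" and "q = r / x\<^sup>2"
  have one: "(sin t)\<^sup>2 + (cos t)\<^sup>2 = 1" by simp
  have co: "cos_coeff r t x y = X\<^sup>2 + q * (sin t)\<^sup>2" "sin_coeff r t x y = Y\<^sup>2 + q * (cos t)\<^sup>2"
    "mixed_coeff r t x y = 2 * X * Y - 2 * q * sin t * cos t"
    by (simp_all add: coeff_defs X_def Y_def q_def)
  have xy: "x = X * cos t + Y * sin t" "y = Y * cos t - X * sin t"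
    using one unfolding X_def Y_def by algebra+
  have "?l = (X * cos t + Y * sin t)\<^sup>2" unfolding co by algebra
  then show "?l = x\<^sup>2" by (simp flip: xy)
  have "?m = 2 * (X * cos t + Y * sin t) * (Y * cos t - X * sin t)" unfolding co by algebra
  then show "?m = 2 * x * y" by (simp flip: xy)
  have "?n = q * (X * cos t + Y * sin t)\<^sup>2"
    unfolding co by (simp add: field_simps power2_eq_square)
  also have "\<dots> = r" using assms by (simp add: q_def flip: xy)
  finally show "?n = r" .
qed

lemma cos_coeff_pos:
  assumes "x > 0" "r > 0"
  shows "cos_coeff r t x y > 0"
proof (cases "sin t = 0")
  case True
  then have "(cos t)\<^sup>2 = 1" using sin_cos_squared_add[of t] by simp
  with True assms show ?thesis
    by (auto simp: cos_coeff_def power_mult_distrib)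
next
  case False
  with assms show ?thesis
    unfolding cos_coeff_def by (intro add_nonneg_pos) auto
qed

text \<open>The rotation absorbs the harmonic part of the equation: \<open>X\<close> and
  \<open>Y\<close> change only through the forcing, at rates \<open>- q * sin t\<close> and
  \<open>q * cos t\<close>. The terms with \<open>r / x^2\<close> are exactly what compensates for
  this. Derivatives within \<open>S\<close> allow one-sided use at the ends of an interval.\<close>

lemma coeffs_has_derivative_zero:
  fixes x x' :: "real \<Rightarrow> real"
  assumes x: "(x has_real_derivative x' t) (at t within S)"
    and x': "(x' has_real_derivative r / x t ^ 3 - x t) (at t within S)"
    and pos: "x t > 0"
  shows "((\<lambda>s. cos_coeff r s (x s) (x' s)) has_real_derivative 0) (at t within S)"
    and "((\<lambda>s. sin_coeff r s (x s) (x' s)) has_real_derivative 0) (at t within S)"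
    and "((\<lambda>s. mixed_coeff r s (x s) (x' s)) has_real_derivative 0) (at t within S)"
proof -
  define q where "q = r / x t ^ 3"
  define X Y where "X = (\<lambda>s. x s * cos s - x' s * sin s)" and "Y = (\<lambda>s. x s * sin s + x' s * cos s)"
  have X: "(X has_real_derivative - q * sin t) (at t within S)"
    unfolding X_def by (auto intro!: derivative_eq_intros x x' simp: q_def algebra_simps)
  have Y: "(Y has_real_derivative q * cos t) (at t within S)"
    unfolding Y_def by (auto intro!: derivative_eq_intros x x' simp: q_def algebra_simps)
  define P where "P = (\<lambda>s. r / (x s)\<^sup>2)"
  have P: "(P has_real_derivative - 2 * q * x' t) (at t within S)"
    unfolding P_def using pos by (auto intro!: derivative_eq_intros x
        simp: q_def field_simps power2_eq_square power3_eq_cube)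
  have qx: "P t = q * x t"
    using pos by (simp add: P_def q_def field_simps power2_eq_square power3_eq_cube)
  have "((\<lambda>s. (X s)\<^sup>2 + P s * (sin s)\<^sup>2) has_real_derivative
      2 * X t * (- q * sin t) + (- 2 * q * x' t * (sin t)\<^sup>2 + P t * (2 * sin t * cos t))) (at t within S)"
    by (auto intro!: derivative_eq_intros X P)
  moreover have "2 * X t * (- q * sin t) + (- 2 * q * x' t * (sin t)\<^sup>2 + P t * (2 * sin t * cos t)) = 0"
    unfolding qx X_def by algebra
  ultimately show "((\<lambda>s. cos_coeff r s (x s) (x' s)) has_real_derivative 0) (at t within S)"
    by (simp add: cos_coeff_def X_def P_def)
  have "((\<lambda>s. (Y s)\<^sup>2 + P s * (cos s)\<^sup>2) has_real_derivative
      2 * Y t * (q * cos t) + (- 2 * q * x' t * (cos t)\<^sup>2 - P t * (2 * sin t * cos t))) (at t within S)"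
    by (auto intro!: derivative_eq_intros Y P)
  moreover have "2 * Y t * (q * cos t) + (- 2 * q * x' t * (cos t)\<^sup>2 - P t * (2 * sin t * cos t)) = 0"
    unfolding qx Y_def by algebra
  ultimately show "((\<lambda>s. sin_coeff r s (x s) (x' s)) has_real_derivative 0) (at t within S)"
    by (simp add: sin_coeff_def Y_def P_def)
  have "((\<lambda>s. 2 * (X s * Y s) - 2 * (P s * (sin s * cos s))) has_real_derivative
      2 * (X t * (q * cos t) + - q * sin t * Y t) -
      2 * (P t * ((cos t)\<^sup>2 - (sin t)\<^sup>2) - 2 * q * x' t * (sin t * cos t))) (at t within S)"
    by (auto intro!: derivative_eq_intros X Y P simp: power2_eq_square)
  moreover have "2 * (X t * (q * cos t) + - q * sin t * Y t) -
      2 * (P t * ((cos t)\<^sup>2 - (sin t)\<^sup>2) - 2 * q * x' t * (sin t * cos t)) = 0"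
    unfolding qx X_def Y_def by algebra
  moreover have "(\<lambda>s. mixed_coeff r s (x s) (x' s)) =
      (\<lambda>s. 2 * (X s * Y s) - 2 * (P s * (sin s * cos s)))"
    by (simp add: fun_eq_iff mixed_coeff_def X_def Y_def P_def algebra_simps)
  ultimately show "((\<lambda>s. mixed_coeff r s (x s) (x' s)) has_real_derivative 0) (at t within S)"
    by simp
qed

section \<open>Caratheodory solutions on intervals of constant forcing\<close>

context
  fixes R :: "real \<Rightarrow> real" and I :: "real set" and x :: "real \<Rightarrow> real"
  assumes sol: "caratheodory_solution R I x"
begin

lemma solution_has_derivative:
  assumes "t \<in> I"
  shows "(x has_real_derivative deriv x t) (at t)"
proof -
  have "at t within I = at t" "x differentiable (at t within I)"
    using sol assms at_within_open[of t I]
    unfolding caratheodory_solution_def differentiable_on_def by blast+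
  then show ?thesis by (simp add: DERIV_deriv_iff_real_differentiable)
qed

text \<open>While \<open>R\<close> is constant, the second derivative equals almost everywhere a
  continuous function of \<open>t\<close>. Absolute continuity writes \<open>deriv x\<close> as the
  integral of that function, so the equation holds at every point, one-sidedly at the ends.\<close>

lemma solution_deriv_has_derivative:
  assumes ab: "{a..b} \<subseteq> I" and t: "t \<in> {a..b}"
    and R: "\<And>s. s \<in> {a..<b} \<Longrightarrow> R s = r"
  shows "(deriv x has_real_derivative r / x t ^ 3 - x t) (at t within {a..b})"
proof -
  define g where "g = (\<lambda>s. r / x s ^ 3 - x s)"
  have pos: "x s > 0" if "s \<in> {a..b}" for s
    using sol ab that unfolding caratheodory_solution_def by auto
  have "continuous_on {a..b} x"
    using solution_has_derivative ab
    by (intro continuous_at_imp_continuous_on) (auto intro: DERIV_isCont)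
  then have cont: "continuous_on {a..b} g"
    unfolding g_def using pos by (intro continuous_intros) force+
  obtain N where N: "N \<in> null_sets lebesgue"
    "{t \<in> space lebesgue. \<not> (t \<in> I \<longrightarrow>
        (\<exists>a. (deriv x has_real_derivative a) (at t) \<and> a + x t = R t / x t ^ 3))} \<subseteq> N"
    using sol unfolding caratheodory_solution_def eventually_ae_filter by blast
  \<comment> \<open>\<open>R\<close> may already have jumped at \<open>b\<close>, so this endpoint
    joins the exceptional set.\<close>
  have "negligible (insert b N)"
    using N(1) by (simp add: negligible_iff_null_sets negligible_insert)
  have incr: "(g has_integral (deriv x u - deriv x a)) {a..u}" if "u \<in> {a..b}" for u
  proof (rule abs_continuous_fundamental_theorem)
    show "a \<le> u" using that by simp
    show "abs_continuous_on {a..u} (deriv x)"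
    proof -
      have "{a..u} \<subseteq> I" using that ab by auto
      then show ?thesis using sol unfolding caratheodory_solution_def by blast
    qed
    show "negligible (insert b N)" by fact
    show "(deriv x has_real_derivative g s) (at s)" if s: "s \<in> {a..u} - insert b N" for s
    proof -
      have s': "s \<in> I" "s \<in> {a..<b}" "s \<notin> N" using s \<open>u \<in> {a..b}\<close> ab by auto
      then obtain d where d: "(deriv x has_real_derivative d) (at s)" "d + x s = R s / x s ^ 3"
        using N(2) by auto
      with R[OF s'(2)] have "d = g s" by (simp add: g_def algebra_simps)
      with d show ?thesis by simp
    qed
  qed
  have "((\<lambda>u. deriv x a + integral {a..u} g) has_real_derivative 0 + g t) (at t within {a..b})"
    using integral_has_vector_derivative[OF cont t]
    by (intro derivative_intros) (simp add: has_real_derivative_iff_has_vector_derivative)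
  then have "((\<lambda>u. deriv x a + integral {a..u} g) has_real_derivative g t) (at t within {a..b})"
    by simp
  moreover have "g t = r / x t ^ 3 - x t" by (simp add: g_def)
  ultimately show ?thesis
    using has_field_derivative_transform_within[of "\<lambda>u. deriv x a + integral {a..u} g" "g t" t "{a..b}" 1 "deriv x"]
      t integral_unique[OF incr] by auto
qed

lemma solution_coeffs_constant:
  assumes ab: "{a..b} \<subseteq> I" and st: "s \<in> {a..b}" "t \<in> {a..b}"
    and R: "\<And>s. s \<in> {a..<b} \<Longrightarrow> R s = r"
  shows "cos_coeff r s (x s) (deriv x s) = cos_coeff r t (x t) (deriv x t)"
    and "sin_coeff r s (x s) (deriv x s) = sin_coeff r t (x t) (deriv x t)"
    and "mixed_coeff r s (x s) (deriv x s) = mixed_coeff r t (x t) (deriv x t)"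
proof -
  have "(x has_real_derivative deriv x u) (at u within {a..b})"
    "(deriv x has_real_derivative r / x u ^ 3 - x u) (at u within {a..b})" "x u > 0"
    if "u \<in> {a..b}" for u
  proof -
    have "u \<in> I" using that ab by auto
    then show "(x has_real_derivative deriv x u) (at u within {a..b})" "x u > 0"
      using solution_has_derivative has_field_derivative_at_within sol
      unfolding caratheodory_solution_def by blast+
    show "(deriv x has_real_derivative r / x u ^ 3 - x u) (at u within {a..b})"
      using solution_deriv_has_derivative[OF ab that R] .
  qed
  note zero = coeffs_has_derivative_zero[OF this]
  note const = has_field_derivative_zero_constant[OF convex_real_interval(5)]
  show "cos_coeff r s (x s) (deriv x s) = cos_coeff r t (x t) (deriv x t)"
    "sin_coeff r s (x s) (deriv x s) = sin_coeff r t (x t) (deriv x t)"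
    "mixed_coeff r s (x s) (deriv x s) = mixed_coeff r t (x t) (deriv x t)"
    using const[OF zero(1)] const[OF zero(2)] const[OF zero(3)] st by metis+
qed

end

text \<open>Equal states at \<open>s\<close> give equal coefficients, which are constant and hence
  still equal at \<open>t\<close>. They determine \<open>x^2\<close> and \<open>x x'\<close> there,
  and positivity selects the root and allows division by it.\<close>

lemma solutions_agree_constant_forcing:
  assumes x: "caratheodory_solution R I x" and y: "caratheodory_solution R J y"
    and ab: "{a..b} \<subseteq> I \<inter> J" and st: "s \<in> {a..b}" "t \<in> {a..b}"
    and R: "\<And>s. s \<in> {a..<b} \<Longrightarrow> R s = r"
    and eq: "x s = y s" "deriv x s = deriv y s"
  shows "x t = y t \<and> deriv x t = deriv y t"
proof -
  have I: "{a..b} \<subseteq> I" and J: "{a..b} \<subseteq> J" using ab by auto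
  have pos: "x t > 0" "y t > 0"
    using x y I J st unfolding caratheodory_solution_def by auto
  note cx = solution_coeffs_constant[OF x I st R] and cy = solution_coeffs_constant[OF y J st R]
  have "cos_coeff r t (x t) (deriv x t) = cos_coeff r t (y t) (deriv y t)"
    "sin_coeff r t (x t) (deriv x t) = sin_coeff r t (y t) (deriv y t)"
    "mixed_coeff r t (x t) (deriv x t) = mixed_coeff r t (y t) (deriv y t)"
    using cx cy eq by simp_all
  then have "(x t)\<^sup>2 = (y t)\<^sup>2" "x t * deriv x t = y t * deriv y t"
    using coeff_reconstruct(1,2)[of "x t" r t "deriv x t"] coeff_reconstruct(1,2)[of "y t" r t "deriv y t"] pos
    by simp_all
  moreover from this(1) have "x t = y t" using pos by (simp add: power2_eq_iff)
  ultimately show ?thesis using pos by simp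
qed

section \<open>Uniqueness across the jumps of the forcing\<close>

abbreviation quarter :: "real \<Rightarrow> int" where
  "quarter t \<equiv> \<lfloor>2 * t / pi\<rfloor>"

lemma quarter_eq_iff: "quarter t = k \<longleftrightarrow> t \<in> {of_int k * pi / 2..<(of_int k + 1) * pi / 2}"
  by (auto simp: floor_eq_iff pos_le_divide_eq pos_divide_less_eq)

lemma solution_unique:
  fixes r :: "int \<Rightarrow> real"
  assumes x: "caratheodory_solution R I x" and y: "caratheodory_solution R J y"
    and R: "\<And>t. R t = r (quarter t)"
    and st: "s \<in> I \<inter> J" "t \<in> I \<inter> J"
    and eq: "x s = y s" "deriv x s = deriv y s"
  shows "x t = y t"
proof -
  define agree where "agree = (\<lambda>t. x t = y t \<and> deriv x t = deriv y t)"
  have sub: "{s..t} \<subseteq> I \<inter> J" if "s \<in> I \<inter> J" "t \<in> I \<inter> J" for s t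
  proof
    fix u assume "u \<in> {s..t}"
    then show "u \<in> I \<inter> J"
      using x y that mem_is_interval_1_I[of I s t u] mem_is_interval_1_I[of J s t u]
      by (simp add: caratheodory_solution_def)
  qed
  \<comment> \<open>Here \<open>t\<close> may be the right end of the quarter of \<open>s\<close>,
    where \<open>R\<close> can take its next value: only the values of \<open>R\<close> on the
    half-open interval enter.\<close>
  have local: "agree s \<longleftrightarrow> agree t"
    if st: "s \<in> I \<inter> J" "t \<in> I \<inter> J" "s \<le> t" "t \<le> (of_int (quarter s) + 1) * pi / 2" for s t
  proof -
    have "R u = r (quarter s)" if "u \<in> {s..<t}" for u
    proof -
      have "u \<in> {of_int (quarter s) * pi / 2..<(of_int (quarter s) + 1) * pi / 2}"
        using that st(4) quarter_eq_iff[of s "quarter s"] by auto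
      then show ?thesis using R quarter_eq_iff[of u] by metis
    qed
    note loc = solutions_agree_constant_forcing[OF x y sub[OF st(1,2)] _ _ this]
    show ?thesis unfolding agree_def using loc[of s t] loc[of t s] st(3) by auto
  qed
  \<comment> \<open>Induction on a bound for the number of jumps between \<open>s\<close> and
    \<open>t\<close>, moving \<open>s\<close> to the next jump \<open>m\<close>. Stating it as an
    equivalence covers propagation forwards and backwards in time at once.\<close>
  have "agree s \<longleftrightarrow> agree t"
    if "s \<in> I \<inter> J" "t \<in> I \<inter> J" "s \<le> t" "quarter t \<le> quarter s + int n" for s t n
    using that
  proof (induction n arbitrary: s)
    case 0
    then have "quarter t = quarter s"
      using floor_mono[of "2 * s / pi" "2 * t / pi"] by (simp add: divide_right_mono)
    with 0 show ?case using quarter_eq_iff[of t] by (intro local) auto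
  next
    case (Suc n)
    define m where "m = (of_int (quarter s) + 1) * pi / 2"
    have m: "s < m" "quarter m = quarter s + 1"
      using quarter_eq_iff[of s "quarter s"] by (auto simp: m_def)
    show ?case
    proof (cases "t \<le> m")
      case True
      then show ?thesis using Suc.prems by (intro local) (auto simp: m_def)
    next
      case False
      then have "m \<in> I \<inter> J" using sub[OF Suc.prems(1,2)] m by auto
      have "agree s \<longleftrightarrow> agree m"
        using local[OF Suc.prems(1) \<open>m \<in> I \<inter> J\<close>] m(1) by (simp add: m_def)
      moreover have "agree m \<longleftrightarrow> agree t"
        using Suc.IH[OF \<open>m \<in> I \<inter> J\<close> Suc.prems(2)] Suc.prems(4) False m(2) by simp
      ultimately show ?thesis by simp
    qed
  qed
  note steps = this
  have "agree s \<longleftrightarrow> agree t" if "s \<in> I \<inter> J" "t \<in> I \<inter> J" "s \<le> t" for s t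
    using that steps[of s t "nat (quarter t - quarter s)"] by linarith
  then have "agree s \<longleftrightarrow> agree t" using st linear[of s t] by blast
  then show ?thesis using eq by (simp add: agree_def)
qed

section \<open>Explicit global solutions\<close>

text \<open>Every point has a neighbourhood covered by at most two closed quarters. This reduces
  limits at the joints to limits within single pieces, where one formula is valid.\<close>

lemma tendsto_quarters:
  fixes g :: "real \<Rightarrow> 'a::topological_space"
  assumes "\<And>k. t \<in> {of_int k * pi / 2..(of_int k + 1) * pi / 2} \<Longrightarrow>
    (g \<longlongrightarrow> l) (at t within {of_int k * pi / 2..(of_int k + 1) * pi / 2})"
  shows "(g \<longlongrightarrow> l) (at t)"
proof -
  define A where "A = (\<lambda>k. {of_int k * pi / 2..(of_int k + 1) * pi / 2})"
  \<comment> \<open>\<open>i\<close> is the quarter reaching \<open>t\<close> from the left, its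
    left end strictly below \<open>t\<close>; \<open>j\<close> is the one to the right. They differ
    only when \<open>t\<close> is a multiple of \<open>pi / 2\<close>.\<close>
  define i j where "i = \<lceil>2 * t / pi\<rceil> - 1" and "j = quarter t"
  have "of_int i < 2 * t / pi" "2 * t / pi \<le> of_int i + 1"
    using ceiling_correct[of "2 * t / pi"] by (auto simp: i_def)
  then have i: "of_int i * pi / 2 < t" "t \<le> (of_int i + 1) * pi / 2"
    by (simp_all add: pos_less_divide_eq pos_divide_le_eq)
  have j: "of_int j * pi / 2 \<le> t" "t < (of_int j + 1) * pi / 2"
    using quarter_eq_iff[of t j] by (auto simp: j_def)
  have "of_int j * pi / 2 \<le> (of_int i + 1) * pi / 2"
    using j(1) i(2) by (rule order_trans)
  then have "{of_int i * pi / 2<..<(of_int j + 1) * pi / 2} \<subseteq> A i \<union> A j"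
    unfolding A_def subset_iff Un_iff atLeastAtMost_iff greaterThanLessThan_iff by (meson less_imp_le linear order_trans)
  then have "t \<in> interior (A i \<union> A j)"
    using i j by (intro interiorI[of "{of_int i * pi / 2<..<(of_int j + 1) * pi / 2}"]) auto
  then have "at t = at t within (A i \<union> A j)" by (rule at_within_interior[symmetric])
  then show ?thesis
    using i j assms[of i] assms[of j] by (simp add: A_def Lim_within_Un)
qed

text \<open>For constant forcing, \<open>u = x^2\<close> satisfies the linear equation
  \<open>u''' + 4 u' = 0\<close>; this is its general solution.\<close>

definition quad :: "real \<Rightarrow> real \<Rightarrow> real \<Rightarrow> real \<Rightarrow> real" where
  "quad a b v t = a * (cos t)\<^sup>2 + b * (sin t)\<^sup>2 + v * sin t * cos t"

definition quad' :: "real \<Rightarrow> real \<Rightarrow> real \<Rightarrow> real \<Rightarrow> real" where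
  "quad' a b v t = 2 * (b - a) * sin t * cos t + v * ((cos t)\<^sup>2 - (sin t)\<^sup>2)"

lemma quad_has_derivative:
  "(quad a b v has_real_derivative quad' a b v t) (at t within S)"
  unfolding quad_def[abs_def] quad'_def
  by (auto intro!: derivative_eq_intros simp: field_simps power2_eq_square)

lemma quad'_has_derivative:
  "(quad' a b v has_real_derivative
      2 * (b - a) * ((cos t)\<^sup>2 - (sin t)\<^sup>2) - 4 * v * sin t * cos t) (at t within S)"
  unfolding quad'_def[abs_def]
  by (auto intro!: derivative_eq_intros simp: field_simps power2_eq_square)

text \<open>Multiplying by \<open>a\<close> and completing the square leaves a sum of two
  nonnegative terms that cannot vanish together.\<close>

lemma quad_pos:
  assumes "a > 0" "a * b - v\<^sup>2 / 4 > 0"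
  shows "quad a b v t > 0"
proof -
  have eq: "a * quad a b v t = (a * cos t + v * sin t / 2)\<^sup>2 + (a * b - v\<^sup>2 / 4) * (sin t)\<^sup>2"
    unfolding quad_def by (simp add: field_simps power2_eq_square)
  have "a * quad a b v t > 0"
  proof (cases "sin t = 0")
    case True
    then have "cos t \<noteq> 0" using sin_cos_squared_add[of t] by auto
    then show ?thesis using True assms by (simp add: eq)
  next
    case False
    then show ?thesis unfolding eq using assms by (intro add_nonneg_pos) auto
  qed
  then show ?thesis using assms by (simp add: zero_less_mult_iff)
qed

lemma sqrt_quad_has_derivative:
  assumes "a > 0" "a * b - v\<^sup>2 / 4 > 0"
  shows "((\<lambda>t. sqrt (quad a b v t)) has_real_derivative quad' a b v t / (2 * sqrt (quad a b v t)))
           (at t within S)"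
  using quad_pos[OF assms, of t]
  by (auto intro!: derivative_eq_intros quad_has_derivative simp: field_simps)

text \<open>For \<open>x = sqrt u\<close> the equation \<open>x'' + x = r / x^3\<close> reads
  \<open>2 u u'' - u'^2 = 4 r - 4 u^2\<close>, which for \<open>u = quad a b v t\<close> is a
  trigonometric identity once \<open>r\<close> is expressed by \<open>a\<close>, \<open>b\<close>,
  \<open>v\<close>.\<close>

lemma sqrt_quad_deriv_has_derivative:
  assumes "a > 0" "r > 0" "a * b - v\<^sup>2 / 4 = r"
  shows "((\<lambda>t. quad' a b v t / (2 * sqrt (quad a b v t))) has_real_derivative
           r / sqrt (quad a b v t) ^ 3 - sqrt (quad a b v t)) (at t within S)"
proof -
  define u u' u'' y where "u = quad a b v t" and "u' = quad' a b v t"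
    and "u'' = 2 * (b - a) * ((cos t)\<^sup>2 - (sin t)\<^sup>2) - 4 * v * sin t * cos t" and "y = sqrt u"
  have "a * b - v\<^sup>2 / 4 > 0" using assms by simp
  note pos = quad_pos[OF assms(1) this, of t] and dy = sqrt_quad_has_derivative[OF assms(1) this]
  have y: "y > 0" "y ^ 2 = u" using pos by (auto simp: y_def u_def)
  have "(sin t)\<^sup>2 + (cos t)\<^sup>2 = 1" "4 * r = 4 * a * b - v\<^sup>2" using assms(3) by simp_all
  then have identity: "2 * u * u'' - u'\<^sup>2 = 4 * r - 4 * u\<^sup>2"
    unfolding u_def u'_def u''_def quad_def quad'_def by algebra
  have "((\<lambda>t. quad' a b v t / (2 * sqrt (quad a b v t))) has_real_derivative
      (u'' * (2 * y) - u' * (2 * (u' / (2 * y)))) / (2 * y * (2 * y))) (at t within S)"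
    using DERIV_divide[OF quad'_has_derivative[of a b v t S] DERIV_cmult[OF dy[of t S], of 2]] y(1)
    by (simp add: u_def u'_def u''_def y_def)
  moreover have "(u'' * (2 * y) - u' * (2 * (u' / (2 * y)))) / (2 * y * (2 * y))
      = (2 * u * u'' - u'\<^sup>2) / (4 * y ^ 3)"
    using y(1) unfolding y(2)[symmetric] by (simp add: field_simps power2_eq_square power3_eq_cube)
  moreover have "(2 * u * u'' - u'\<^sup>2) / (4 * y ^ 3) = r / y ^ 3 - y"
    unfolding identity using y(1) unfolding y(2)[symmetric]
    by (simp add: field_simps power2_eq_square power3_eq_cube)
  ultimately show ?thesis by (simp add: y_def u_def)
qed

section \<open>Gluing the pieces into a solution on the whole line\<close>

definition glued_solution :: "(int \<Rightarrow> real) \<Rightarrow> (int \<Rightarrow> real) \<Rightarrow> real \<Rightarrow> real \<Rightarrow> real" where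
  "glued_solution a b v t = sqrt (quad (a (quarter t)) (b (quarter t)) v t)"

definition glued_deriv :: "(int \<Rightarrow> real) \<Rightarrow> (int \<Rightarrow> real) \<Rightarrow> real \<Rightarrow> real \<Rightarrow> real" where
  "glued_deriv a b v t =
     quad' (a (quarter t)) (b (quarter t)) v t / (2 * glued_solution a b v t)"

text \<open>
  At \<open>t = (k + 1) \<pi> / 2\<close> either \<open>sin t = 0\<close> or \<open>cos t = 0\<close>, so only one of the coefficients has
  to match there for the pieces to fit together with their first derivatives.
\<close>

context
  fixes a b r :: "int \<Rightarrow> real" and v C :: real and R :: "real \<Rightarrow> real"
  assumes R: "\<And>t. R t = r (quarter t)"
    and r: "\<And>k. r k > 0" "\<And>k. r k \<le> C"
    and a: "\<And>k. a k > 0"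
    and disc: "\<And>k. a k * b k - v\<^sup>2 / 4 = r k"
    and match_a: "\<And>k. odd k \<Longrightarrow> a (k + 1) = a k"
    and match_b: "\<And>k. even k \<Longrightarrow> b (k + 1) = b k"
begin

text \<open>At the right end \<open>quarter t\<close> is already \<open>k + 1\<close>, but the
  coefficient that may have changed is multiplied by a factor vanishing there. Validity on the
  closed quarter is what \<open>tendsto_quarters\<close> requires.\<close>

lemma glued_on_piece:
  assumes t: "t \<in> {of_int k * pi / 2..(of_int k + 1) * pi / 2}"
  shows "glued_solution a b v t = sqrt (quad (a k) (b k) v t)"
    and "glued_deriv a b v t = quad' (a k) (b k) v t / (2 * sqrt (quad (a k) (b k) v t))"
proof -
  have "quad (a (quarter t)) (b (quarter t)) v t = quad (a k) (b k) v t \<and>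
        quad' (a (quarter t)) (b (quarter t)) v t = quad' (a k) (b k) v t"
  proof (cases "t = (of_int k + 1) * pi / 2")
    case False
    then have "quarter t = k" using t by (subst quarter_eq_iff) auto
    then show ?thesis by simp
  next
    case True
    then have q: "quarter t = k + 1" by (subst quarter_eq_iff) auto
    show ?thesis
    proof (cases "even k")
      case even: True
      then obtain m where m: "k = 2 * m" by blast
      have "t = pi * of_int m + pi / 2" using True by (simp add: m field_simps)
      then have "cos t = 0" using sin_npi_int[of m] by (simp add: cos_add)
      then show ?thesis using match_b[OF even] by (simp add: q quad_def quad'_def)
    next
      case odd: False
      then obtain m where m: "k = 2 * m + 1" using oddE by blast
      have "t = pi * of_int (m + 1)" using True by (simp add: m field_simps)
      then have "sin t = 0" using sin_npi_int[of "m + 1"] by simp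
      then show ?thesis using match_a[OF odd] by (simp add: q quad_def quad'_def)
    qed
  qed
  then show "glued_solution a b v t = sqrt (quad (a k) (b k) v t)"
    "glued_deriv a b v t = quad' (a k) (b k) v t / (2 * sqrt (quad (a k) (b k) v t))"
    by (simp_all add: glued_solution_def glued_deriv_def)
qed

lemma disc_pos: "a k * b k - v\<^sup>2 / 4 > 0"
  using disc r by simp

lemma glued_solution_pos: "glued_solution a b v t > 0"
  using quad_pos[OF a disc_pos] by (simp add: glued_solution_def)

lemma glued_solution_has_derivative:
  "(glued_solution a b v has_real_derivative glued_deriv a b v t) (at t)"
  unfolding has_field_derivative_iff
proof (rule tendsto_quarters, fold has_field_derivative_iff)
  fix k assume t: "t \<in> {of_int k * pi / 2..(of_int k + 1) * pi / 2}"
  show "(glued_solution a b v has_real_derivative glued_deriv a b v t)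
      (at t within {of_int k * pi / 2..(of_int k + 1) * pi / 2})"
    unfolding glued_on_piece(2)[OF t]
    by (rule has_field_derivative_transform_within[OF sqrt_quad_has_derivative[OF a disc_pos] zero_less_one t])
      (simp add: glued_on_piece(1))
qed

lemma glued_deriv_isCont: "isCont (glued_deriv a b v) t"
  unfolding isCont_def
proof (rule tendsto_quarters)
  fix k assume t: "t \<in> {of_int k * pi / 2..(of_int k + 1) * pi / 2}"
  have "((\<lambda>t. quad' (a k) (b k) v t / (2 * sqrt (quad (a k) (b k) v t))) \<longlongrightarrow> glued_deriv a b v t)
      (at t within {of_int k * pi / 2..(of_int k + 1) * pi / 2})"
    using DERIV_continuous[OF sqrt_quad_deriv_has_derivative[OF a r(1) disc]]
    by (simp add: glued_on_piece(2)[OF t] continuous_within)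
  then show "(glued_deriv a b v \<longlongrightarrow> glued_deriv a b v t)
      (at t within {of_int k * pi / 2..(of_int k + 1) * pi / 2})"
    by (rule Lim_transform_within[OF _ zero_less_one]) (simp add: glued_on_piece(2))
qed

lemma glued_deriv_has_derivative:
  assumes "t \<notin> range (\<lambda>k::int. of_int k * pi / 2)"
  shows "(glued_deriv a b v has_real_derivative
    R t / glued_solution a b v t ^ 3 - glued_solution a b v t) (at t)"
proof -
  define k where "k = quarter t"
  have "t \<in> {of_int k * pi / 2..<(of_int k + 1) * pi / 2}"
    using quarter_eq_iff[of t k] by (simp add: k_def)
  moreover have "t \<noteq> of_int k * pi / 2" using assms by blast
  ultimately have t: "t \<in> {of_int k * pi / 2<..<(of_int k + 1) * pi / 2}" by auto
  have "(glued_deriv a b v has_real_derivative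
      r k / sqrt (quad (a k) (b k) v t) ^ 3 - sqrt (quad (a k) (b k) v t)) (at t)"
  proof (rule has_field_derivative_transform_within_open[OF sqrt_quad_deriv_has_derivative[OF a r(1) disc] _ t])
    fix w assume "w \<in> {of_int k * pi / 2<..<(of_int k + 1) * pi / 2}"
    then have "w \<in> {of_int k * pi / 2..(of_int k + 1) * pi / 2}" by auto
    then show "quad' (a k) (b k) v w / (2 * sqrt (quad (a k) (b k) v w)) = glued_deriv a b v w"
      by (simp only: glued_on_piece(2))
  qed simp
  then show ?thesis by (simp add: R k_def glued_solution_def)
qed

text \<open>On a compact interval the glued solution lies between positive bounds \<open>m\<close>
  and \<open>M\<close>, so the second derivative is bounded by \<open>C / m ^ 3 + M\<close> wherever
  it is known to exist. Integrating this bound gives the Lipschitz estimate, from which absolute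
  continuity follows.\<close>

lemma glued_deriv_lipschitz:
  obtains L where "L \<ge> 0"
    "\<And>s t. l \<le> s \<Longrightarrow> s \<le> t \<Longrightarrow> t \<le> h \<Longrightarrow> \<bar>glued_deriv a b v t - glued_deriv a b v s\<bar> \<le> L * (t - s)"
proof (cases "l \<le> h")
  case False
  then show ?thesis using that[of 0] by auto
next
  case True
  have cont: "continuous_on {l..h} (glued_solution a b v)"
    using glued_solution_has_derivative by (intro continuous_at_imp_continuous_on) (auto intro: DERIV_isCont)
  obtain p where p: "\<And>t. t \<in> {l..h} \<Longrightarrow> glued_solution a b v p \<le> glued_solution a b v t"
    using continuous_attains_inf[OF compact_Icc _ cont] True by (metis atLeastatMost_empty_iff2)
  obtain q where q: "\<And>t. t \<in> {l..h} \<Longrightarrow> glued_solution a b v t \<le> glued_solution a b v q"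
    using continuous_attains_sup[OF compact_Icc _ cont] True by (metis atLeastatMost_empty_iff2)
  define m M where "m = glued_solution a b v p" and "M = glued_solution a b v q"
  have pos: "m > 0" "M > 0" "C > 0"
    using glued_solution_pos r[of 0] by (auto simp: m_def M_def)
  define g where "g = (\<lambda>t. R t / glued_solution a b v t ^ 3 - glued_solution a b v t)"
  define L where "L = C / m ^ 3 + M"
  have g: "\<bar>g t\<bar> \<le> L" if "t \<in> {l..h}" for t
  proof -
    have "R t / glued_solution a b v t ^ 3 \<le> C / m ^ 3"
      using p[OF that] pos r by (intro frac_le power_mono) (auto simp: R m_def)
    moreover have "R t / glued_solution a b v t ^ 3 \<ge> 0"
      using glued_solution_pos[of t] r(1) by (simp add: R less_imp_le)
    ultimately show ?thesis
      using q[OF that] glued_solution_pos[of t] pos(1,3) by (auto simp: g_def L_def M_def abs_le_iff add_increasing)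
  qed
  have L: "L \<ge> 0" using pos by (simp add: L_def)
  show ?thesis
  proof (rule that[OF L])
    fix s t assume st: "l \<le> s" "s \<le> t" "t \<le> h"
    \<comment> \<open>Finitely many candidates for jumps, including all those strictly between
      \<open>s\<close> and \<open>t\<close>.\<close>
    define S where "S = (\<lambda>k::int. of_int k * pi / 2) ` {quarter s..quarter t}"
    have "(g has_integral (glued_deriv a b v t - glued_deriv a b v s)) {s..t}"
    proof (rule fundamental_theorem_of_calculus_interior_strong[of S])
      show "finite S" by (simp add: S_def)
      show "(glued_deriv a b v has_vector_derivative g u) (at u)" if u: "u \<in> {s<..<t} - S" for u
      proof -
        have "u \<notin> range (\<lambda>k::int. of_int k * pi / 2)"
        proof
          assume "u \<in> range (\<lambda>k::int. of_int k * pi / 2)"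
          then obtain k :: int where k: "u = of_int k * pi / 2" by blast
          then have "quarter u = k" by (subst quarter_eq_iff) auto
          moreover have "quarter s \<le> quarter u" "quarter u \<le> quarter t"
            using u by (auto intro!: floor_mono divide_right_mono)
          ultimately show False using u k by (auto simp: S_def)
        qed
        from glued_deriv_has_derivative[OF this] show ?thesis
          by (simp add: g_def has_real_derivative_iff_has_vector_derivative)
      qed
      show "continuous_on {s..t} (glued_deriv a b v)"
        by (intro continuous_at_imp_continuous_on ballI glued_deriv_isCont)
    qed (use st in simp)
    from has_integral_bound_real[OF L finite.emptyI this] g st
    show "\<bar>glued_deriv a b v t - glued_deriv a b v s\<bar> \<le> L * (t - s)" by auto
  qed
qed

theorem glued_solution_caratheodory: "caratheodory_solution R UNIV (glued_solution a b v)"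
  and deriv_glued_solution: "deriv (glued_solution a b v) = glued_deriv a b v"
proof -
  show d: "deriv (glued_solution a b v) = glued_deriv a b v"
    using glued_solution_has_derivative by (intro ext DERIV_imp_deriv)
  show "caratheodory_solution R UNIV (glued_solution a b v)"
    unfolding caratheodory_solution_def d
  proof (intro conjI allI impI ballI)
    show "glued_solution a b v differentiable_on UNIV"
      using glued_solution_has_derivative real_differentiable_def
      by (fastforce simp: differentiable_on_def)
    show "abs_continuous_on {l..h} (glued_deriv a b v)" for l h
      using glued_deriv_lipschitz lipschitz_imp_abs_continuous_on by metis
    have "range (\<lambda>k::int. of_int k * pi / 2) \<in> null_sets lebesgue"
      by (intro null_sets_completionI countable_imp_null_set_lborel) simp
    then show "AE t in lebesgue. t \<in> UNIV \<longrightarrow> (\<exists>d. (glued_deriv a b v has_real_derivative d) (at t) \<and>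
        d + glued_solution a b v t = R t / glued_solution a b v t ^ 3)"
      using glued_deriv_has_derivative
      by (intro AE_I'[of "range (\<lambda>k::int. of_int k * pi / 2)"])
        (auto, force)
  qed (use glued_solution_pos in auto)
qed

end

section \<open>Unboundedness\<close>

lemma periodic_int:
  fixes R :: "real \<Rightarrow> real"
  assumes "\<And>t. R (t + p) = R t"
  shows "R (t + of_int n * p) = R t"
proof (induction n rule: int_induct[where k = 0])
  case (step1 i)
  then show ?case using assms[of "t + of_int i * p"] by (simp add: algebra_simps)
next
  case (step2 i)
  then show ?case using assms[of "t + of_int (i - 1) * p"] by (simp add: algebra_simps)
qed simp

lemma unbounded_onI:
  assumes "\<And>n. \<tau> n \<in> I" "filterlim (\<lambda>n. x (\<tau> n)) at_top sequentially"
  shows "unbounded_on I x"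
  unfolding unbounded_on_def
  using assms by (intro exI[of _ \<tau>] conjI allI filterlim_at_top_mono[OF assms(2)] always_eventually) auto

lemma sqrt_geometric_at_top:
  fixes q C :: real
  assumes "q > 1" "C > 0"
  shows "filterlim (\<lambda>n. sqrt (C * q ^ n)) at_top sequentially"
proof -
  have "filterlim (\<lambda>n. q ^ n) at_top sequentially"
    using filterlim_realpow_sequentially_gt1[of q] assms(1)
    by (intro filterlim_at_infinity_imp_filterlim_at_top) auto
  then have "filterlim (\<lambda>n. C * q ^ n) at_top sequentially"
    by (rule filterlim_tendsto_pos_mult_at_top[OF tendsto_const \<open>C > 0\<close>])
  then show ?thesis by (rule filterlim_compose[OF sqrt_at_top])
qed

theorem theorem3:
  fixes c :: real and R :: "real \<Rightarrow> real"
  assumes "c > 0"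
    and "\<And>t. R (t + pi) = R t"
    and "\<And>t. t \<in> {0..<pi / 2} \<Longrightarrow> R t = 1"
    and "\<And>t. t \<in> {pi / 2..<pi} \<Longrightarrow> R t = c"
    and "c \<noteq> 1"
  shows "\<forall>I x. maximal_solution R I x \<longrightarrow> unbounded_on I x"
proof (intro allI impI)
  fix I x assume max: "maximal_solution R I x"
  then have sol: "caratheodory_solution R I x" by (simp add: maximal_solution_def)
  define r :: "int \<Rightarrow> real" where "r = (\<lambda>k. if even k then 1 else c)"
  have r: "r k > 0" "r k \<le> 1 + c" for k
    using assms(1) by (auto simp: r_def)
  have R: "R t = r (quarter t)" for t
  proof -
    \<comment> \<open>\<open>n\<close> counts whole periods, so the parity of \<open>k\<close> tells
      in which half of the period \<open>s\<close> lies.\<close>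
    define k n where "k = quarter t" and "n = k div 2"
    define s where "s = t - of_int n * pi"
    have t: "t \<in> {of_int k * pi / 2..<(of_int k + 1) * pi / 2}"
      using quarter_eq_iff[of t k] by (simp add: k_def)
    have "R t = R s"
      using periodic_int[of R pi s n, OF assms(2)] by (simp add: s_def)
    also have "R s = r k"
    proof (cases "even k")
      case True
      then have "k = 2 * n" by (simp add: n_def)
      with t have "s \<in> {0..<pi / 2}" by (simp add: s_def distrib_right add_divide_distrib)
      then show ?thesis using True assms(3) by (simp add: r_def)
    next
      case False
      then have "k = 2 * n + 1" unfolding n_def by presburger
      with t have "s \<in> {pi / 2..<pi}" by (simp add: s_def distrib_right add_divide_distrib)
      then show ?thesis using False assms(4) by (simp add: r_def)
    qed
    finally show ?thesis by (simp add: k_def)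
  qed
  obtain t0 where t0: "t0 \<in> I"
    using sol by (auto simp: caratheodory_solution_def)
  \<comment> \<open>The offset \<open>m\<close> normalises the exponent in \<open>a\<close> below to
    0 at the initial quarter \<open>k0\<close>.\<close>
  define x0 y0 k0 m where "x0 = x t0" and "y0 = deriv x t0" and "k0 = quarter t0" and "m = (k0 + 1) div 2"
  have x0: "x0 > 0" using sol t0 by (simp add: x0_def caratheodory_solution_def)
  define A B v where "A = cos_coeff (r k0) t0 x0 y0" and "B = sin_coeff (r k0) t0 x0 y0"
    and "v = mixed_coeff (r k0) t0 x0 y0"
  \<comment> \<open>The product \<open>a k * b k\<close> has to be \<open>K\<close> on even quarters
    and \<open>K * q\<close> on odd ones.\<close>
  define K q where "K = v\<^sup>2 / 4 + 1" and "q = (v\<^sup>2 / 4 + c) / K"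
  have K: "K > 0" by (auto simp: K_def intro: add_nonneg_pos)
  have Kq: "K * q = v\<^sup>2 / 4 + c" using K by (simp add: q_def)
  have "v\<^sup>2 / 4 + c > 0" using assms(1) by (intro add_nonneg_pos) auto
  then have q: "q > 0" using K by (simp add: q_def)
  have q1: "q \<noteq> 1" using Kq assms(5) by (auto simp: K_def)
  have A: "A > 0" unfolding A_def using cos_coeff_pos[OF x0 r(1)] .
  \<comment> \<open>\<open>(k + 1) div 2\<close> grows when \<open>k\<close> passes from even to
    odd, at a zero of \<open>cos\<close>, and \<open>k div 2\<close> when \<open>k\<close> passes
    from odd to even, at a zero of \<open>sin\<close>. So \<open>a\<close> and \<open>b\<close>
    change in turn, by the factors \<open>q\<close> and \<open>1 / q\<close>; integer powers also
    cover the quarters before \<open>k0\<close>.\<close>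
  define a b where "a = (\<lambda>k. A * q powi ((k + 1) div 2 - m))"
    and "b = (\<lambda>k. K / (A * q powi (k div 2 - m)))"
  have a: "a k > 0" for k using A q by (simp add: a_def)
  have disc: "a k * b k - v\<^sup>2 / 4 = r k" for k
  proof (cases "even k")
    case True
    then have "(k + 1) div 2 = k div 2" by presburger
    then show ?thesis using A q True by (simp add: a_def b_def r_def K_def)
  next
    case False
    then have step: "(k + 1) div 2 - m = (k div 2 - m) + 1" by presburger
    have "q powi ((k + 1) div 2 - m) = q powi (k div 2 - m) * q"
      unfolding step using q by (subst power_int_add_1) auto
    then have "a k * b k = K * q" using A q by (simp add: a_def b_def)
    then show ?thesis using False Kq by (simp add: r_def)
  qed
  have match_a: "a (k + 1) = a k" if "odd k" for k
  proof -
    have "(k + 1 + 1) div 2 = (k + 1) div 2" using that by presburger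
    then show ?thesis by (simp add: a_def)
  qed
  have match_b: "b (k + 1) = b k" if "even k" for k
  proof -
    have "(k + 1) div 2 = k div 2" using that by presburger
    then show ?thesis by (simp add: b_def)
  qed
  note glued = glued_solution_caratheodory[of R r "1 + c" a b v, OF R r a disc match_a match_b]
    deriv_glued_solution[of R r "1 + c" a b v, OF R r a disc match_a match_b]
  have "a k0 = A" by (simp add: a_def m_def)
  moreover have "A * B - v\<^sup>2 / 4 = r k0"
    using coeff_reconstruct(3)[of x0 "r k0" t0 y0] x0 by (simp add: A_def B_def v_def)
  \<comment> \<open>As \<open>a k0 = A\<close> is positive, the discriminant relation determines the
    other coefficient at \<open>k0\<close>.\<close>
  then have "A * B = A * b k0" using disc[of k0] unfolding \<open>a k0 = A\<close> by linarith
  then have "b k0 = B" using A by simp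
  ultimately have "glued_solution a b v t0 = x0" "glued_deriv a b v t0 = y0"
    using coeff_reconstruct(1,2)[of x0 "r k0" t0 y0] x0
    by (simp_all add: glued_solution_def glued_deriv_def quad_def quad'_def A_def B_def v_def flip: k0_def)
  then have xy: "x t = glued_solution a b v t" if "t \<in> I" for t
    using solution_unique[OF sol glued(1) R, of t0 t] t0 that by (simp add: glued(2) x0_def y0_def)
  \<comment> \<open>Otherwise the glued solution would properly extend \<open>x\<close>, against
    maximality.\<close>
  have "I = UNIV"
    using max xy glued(1) unfolding maximal_solution_def by (metis UNIV_I psubsetI subset_UNIV)
  define C where "C = A * q powi (- m)"
  have C: "C > 0" using A q by (simp add: C_def)
  have C_power: "A * q powi (int n - m) = C * q ^ n" for n
    using power_int_add[of q "int n" "- m"] q by (simp add: C_def mult.assoc mult.commute[of "q powi (- m)"])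
  have x_even: "x (of_nat n * pi) = sqrt (C * q ^ n)" for n
  proof -
    have "quarter (of_nat n * pi) = 2 * int n" by (subst quarter_eq_iff) auto
    moreover have "(cos (of_nat n * pi))\<^sup>2 = 1" by (simp flip: power_mult)
    moreover have "(2 * int n + 1) div 2 = int n" by presburger
    ultimately have "x (of_nat n * pi) = sqrt (A * q powi (int n - m))"
      by (simp add: xy \<open>I = UNIV\<close> glued_solution_def quad_def a_def)
    then show ?thesis by (simp only: C_power)
  qed
  have x_odd: "x (of_nat n * pi + pi / 2) = sqrt (K / C * (1 / q) ^ n)" for n
  proof -
    have "quarter (of_nat n * pi + pi / 2) = 2 * int n + 1"
      by (subst quarter_eq_iff) (auto simp: algebra_simps add_divide_distrib)
    moreover have "(sin (of_nat n * pi + pi / 2))\<^sup>2 = 1" by (simp add: sin_add flip: power_mult)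
    moreover have "(2 * int n + 1) div 2 = int n" by presburger
    ultimately have "x (of_nat n * pi + pi / 2) = sqrt (K / (A * q powi (int n - m)))"
      by (simp add: xy \<open>I = UNIV\<close> glued_solution_def quad_def b_def cos_add)
    then show ?thesis unfolding C_power by (simp add: power_one_over)
  qed
  show "unbounded_on I x"
  \<comment> \<open>Forward times suffice in both cases: for \<open>q > 1\<close> the squares at
    multiples of \<open>pi\<close> grow geometrically, for \<open>q < 1\<close> those half a period
    later.\<close>
  proof (cases "q > 1")
    case True
    show ?thesis
      by (rule unbounded_onI[where \<tau> = "\<lambda>n. of_nat n * pi"])
        (use sqrt_geometric_at_top[OF True C] in \<open>simp_all add: x_even \<open>I = UNIV\<close>\<close>)
  next
    case False
    with q q1 have "1 / q > 1" by simp
    then show ?thesis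
      using sqrt_geometric_at_top[of "1 / q" "K / C"] K C
      by (intro unbounded_onI[where \<tau> = "\<lambda>n. of_nat n * pi + pi / 2"])
        (simp_all add: x_odd \<open>I = UNIV\<close>)
  qed
qed

end
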